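(* Fix a time step $t\ge 0$. For each $j\in\{1,\dots,\tilde M\}$ let $\mathcal{E}_t^{(j)}\subseteq\mathbb{R}^{nN}$ be a set such that $$\mathbf{\Gamma}\bigl(\boldsymbol{\eta}_t^{(h)}-\tilde{\boldsymbol{\eta}}_t^{(j)}\bigr)\in\mathcal{E}_t^{(j)}\qquad\text{for all } h\in\mathcal{C}^{(j)},$$ and define the tightened constraint set $$\tilde{\mathcal{F}}(x_t,\tilde{\mathbb{P}}):=\Bigl\{\mathbf{u}_t\in\mathbb{R}^{mN}:\ \sum_{j=1}^{\tilde M}\tilde p^{(j)}\,\mathbf{1}_{\tilde{\mathbf{x}}_t^{(j)}\in\mathcal{X}_N\ominus\mathcal{E}_t^{(j)}}\ \ge\ 1-\varepsilon,\quad \mathbf{u}_t\in\mathcal{U}_N\Bigr\},$$ where $\tilde{\mathbf{x}}_t^{(j)}=\mathbf{F}x_t+\mathbf{G}\mathbf{u}_t+\mathbf{\Gamma}\tilde{\boldsymbol{\eta}}_t^{(j)}$. Then $$\tilde{\mathcal{F}}(x_t,\tilde{\mathbb{P}})\subseteq\mathcal{F}(x_t,\mathbb{P})\qquad\text{for all } x_t\in\mathcal{X}.$$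
   Context: **System.** Consider the discrete-time linear system $x_{t+1}=Ax_t+Bu_t+\eta_t$ with $x_t\in\mathbb{R}^n$, $u_t\in\mathbb{R}^m$, $\eta_t\in\mathbb{R}^n$, and a prediction horizon $N\ge 1$. For stacked vectors $\mathbf{u}_t=(u_t,\dots,u_{t+N-1})\in\mathbb{R}^{mN}$, $\boldsymbol{\eta}_t=(\eta_t,\dots,\eta_{t+N-1})\in\mathbb{R}^{nN}$, the stacked state $\mathbf{x}_t=(x_{t+1},\dots,x_{t+N})\in\mathbb{R}^{nN}$ satisfies $\mathbf{x}_t=\mathbf{F}x_t+\mathbf{G}\mathbf{u}_t+\mathbf{\Gamma}\boldsymbol{\eta}_t$, where $\mathbf{F},\mathbf{G},\mathbf{\Gamma}$ are the matrices determined by the dynamics, i.e. by $x_{t+k}=A^kx_t+\sum_{i=0}^{k-1}A^{k-1-i}(Bu_{t+i}+\eta_{t+i})$, $k=1,\dots,N$. **Constraints.** $\mathcal{X}=\{x\in\mathbb{R}^n: H_xx\le h_x\}$ and $\mathcal{U}=\{u\in\mathbb{R}^m:H_uu\le h_u\}$ are convex polytopic sets; $\mathcal{X}_N=\{\mathbf{x}\in\mathbb{R}^{nN}:\mathbf{H}_x\mathbf{x}\le\mathbf{h}_x\}$ and $\mathcal{U}_N=\{\mathbf{u}\in\mathbb{R}^{mN}:\mathbf{H}_u\mathbf{u}\le\mathbf{h}_u\}$ with $\mathbf{H}_x=\mathrm{diag}(H_x,\dots,H_x)$, $\mathbf{H}_u=\mathrm{diag}(H_u,\dots,H_u)$ block-diagonal,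 and $\mathbf{h}_x,\mathbf{h}_u$ the stacked copies of $h_x,h_u$ ($N$ blocks each); i.e. $\mathcal{X}_N$, $\mathcal{U}_N$ are the $N$-fold products of $\mathcal{X}$, $\mathcal{U}$. $\varepsilon\in[0,1)$ is a risk-tolerance parameter. $\mathbf{1}_X$ equals $1$ if the statement $X$ is true and $0$ otherwise. $\ominus$ is the Minkowski (Pontryagin) difference: $\mathcal{A}\ominus\mathcal{B}=\{a: a+b\in \mathcal{A}\ \forall b\in \mathcal{B}\}$. **Original scenarios.** The distribution $\mathbb{P}$ of the disturbance signal is discrete with $M$ scenarios: scenario $j$ is a time series $(\eta_t^{(j)})_{t\ge0}$, occurring with probability $p^{(j)}\in(0,1]$, $\sum_{j=1}^Mp^{(j)}=1$. $\boldsymbol{\eta}_t^{(j)}=(\eta_t^{(j)},\dots,\eta_{t+N-1}^{(j)})\in\mathbb{R}^{nN}$ is the stacked scenario. The original feasible set is $$\mathcal{F}(x_t,\mathbb{P})=\Bigl\{\mathbf{u}_t\in\mathbb{R}^{mN}:\ \sum_{j=1}^{M}p^{(j)}\mathbf{1}_{\mathbf{x}_t^{(j)}\in\mathcal{X}_N}\ge1-\varepsilon,\ \mathbf{u}_t\in\mathcal{U}_N\Bigr\},\qquad \mathbf{x}_t^{(j)}=\mathbf{F}x_t+\mathbf{G}\mathbf{u}_t+\mathbf{\Gamma}\boldsymbol{\eta}_t^{(j)}.$$ **Reduced scenarios.** The reduced distribution $\tilde{\mathbb{P}}$ has $\tilde M<M$ representative stacked scenarios $\tilde{\boldsymbol{\eta}}_t^{(1)},\dots,\tilde{\boldsymbol{\eta}}_t^{(\tilde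 M)}\in\mathbb{R}^{nN}$. The cluster $\mathcal{C}^{(j)}\subseteq\{1,\dots,M\}$ is the set of indices $h$ whose scenario $\boldsymbol{\eta}_t^{(h)}$ is assigned to $\tilde{\boldsymbol{\eta}}_t^{(j)}$ as its closest representative, $\mathcal{C}^{(j)}=\{h:\arg\min_{i\in\{1,\dots,\tilde M\}}\|\boldsymbol{\eta}_t^{(h)}-\tilde{\boldsymbol{\eta}}_t^{(i)}\|_l^l=j\}$, with $l\in\{1,2\}$ fixed (ties broken so that each $h$ belongs to exactly one cluster, i.e. the clusters partition $\{1,\dots,M\}$). The probability of representative $j$ is $\tilde p^{(j)}=\sum_{h\in\mathcal{C}^{(j)}}p^{(h)}$, and it is assumed that $\tilde p^{(j)}\in(0,1]$. *)

theory Defs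
  imports Complex_Main "Jordan_Normal_Form.Matrix"
begin

(* The stacked vector (v 0, ..., v (N - 1)) of N blocks of length d. *)
definition stack :: "nat \<Rightarrow> nat \<Rightarrow> (nat \<Rightarrow> real vec) \<Rightarrow> real vec" where
  "stack d N v = vec (N * d) (\<lambda>i. v (i div d) $ (i mod d))"

(* The k-th block row (k = 0, ..., N - 1) of the next three matrices describes x_{t+k+1}, in
     x_{t+k+1} = A^(k+1) x_t + (\<Sum>i\<le>k. A^(k-i) (B u_{t+i} + \<eta>_{t+i})).
   The lemma stacked_dynamics below checks them against the recursion. *)
definition F_mat :: "nat \<Rightarrow> real mat \<Rightarrow> real mat" where
  "F_mat N A = mat (N * dim_row A) (dim_row A)
     (\<lambda>(r, c). (A ^\<^sub>m (r div dim_row A + 1)) $$ (r mod dim_row A, c))"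

definition G_mat :: "nat \<Rightarrow> real mat \<Rightarrow> real mat \<Rightarrow> real mat" where
  "G_mat N A B = mat (N * dim_row A) (N * dim_col B)
     (\<lambda>(r, c). if c div dim_col B \<le> r div dim_row A
        then (A ^\<^sub>m (r div dim_row A - c div dim_col B) * B) $$ (r mod dim_row A, c mod dim_col B)
        else 0)"

definition Gamma_mat :: "nat \<Rightarrow> real mat \<Rightarrow> real mat" where
  "Gamma_mat N A = G_mat N A (1\<^sub>m (dim_row A))"

definition stacked_state ::
  "nat \<Rightarrow> real mat \<Rightarrow> real mat \<Rightarrow> real vec \<Rightarrow> real vec \<Rightarrow> real vec \<Rightarrow> real vec" where
  "stacked_state N A B x u \<eta> = F_mat N A *\<^sub>v x + G_mat N A B *\<^sub>v u + Gamma_mat N A *\<^sub>v \<eta>"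

(* The order on vectors is componentwise. *)
definition polytopic_set :: "real mat \<Rightarrow> real vec \<Rightarrow> real vec set" where
  "polytopic_set H h = {x \<in> carrier_vec (dim_col H). H *\<^sub>v x \<le> h}"

(* The N-fold product of polytopic_set H h: see stacked_polytopic_set_iff below. *)
definition stacked_polytopic_set :: "nat \<Rightarrow> real mat \<Rightarrow> real vec \<Rightarrow> real vec set" where
  "stacked_polytopic_set N H h =
     polytopic_set (diag_block_mat (replicate N H)) (stack (dim_vec h) N (\<lambda>_. h))"

(* The ambient dimension d is explicit: a ranges over R^d, also when Y is empty. *)
definition minkowski_diff :: "nat \<Rightarrow> real vec set \<Rightarrow> real vec set \<Rightarrow> real vec set" where
  "minkowski_diff d X Y = {a \<in> carrier_vec d. \<forall>b\<in>Y. a + b \<in> X}"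

(* The l-th power of the l-norm, for l \<ge> 1. *)
definition lnorm_pow :: "nat \<Rightarrow> real vec \<Rightarrow> real" where
  "lnorm_pow l v = (\<Sum>i<dim_vec v. \<bar>v $ i\<bar> ^ l)"

(* Ties may be broken in any way: each h lies in exactly one cluster, and that cluster belongs
   to some closest representative of scenario h. *)
definition is_clustering ::
  "nat \<Rightarrow> nat \<Rightarrow> (nat \<Rightarrow> real vec) \<Rightarrow> nat \<Rightarrow> (nat \<Rightarrow> real vec) \<Rightarrow> (nat \<Rightarrow> nat set) \<Rightarrow> bool" where
  "is_clustering l M \<eta> M' \<eta>' C \<longleftrightarrow>
     (\<forall>j\<in>{1..M'}. C j \<subseteq> {1..M}) \<and>
     (\<forall>h\<in>{1..M}. \<exists>!j. j \<in> {1..M'} \<and> h \<in> C j) \<and>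
     (\<forall>j\<in>{1..M'}. \<forall>h\<in>C j. is_arg_min (\<lambda>i. lnorm_pow l (\<eta> h - \<eta>' i)) (\<lambda>i. i \<in> {1..M'}) j)"

(* Here and below \<eta> j is the stacked scenario with index j. *)
definition feasible_set ::
  "nat \<Rightarrow> real mat \<Rightarrow> real mat \<Rightarrow> real mat \<Rightarrow> real vec \<Rightarrow> real mat \<Rightarrow> real vec \<Rightarrow> real \<Rightarrow>
   nat \<Rightarrow> (nat \<Rightarrow> real) \<Rightarrow> (nat \<Rightarrow> real vec) \<Rightarrow> real vec \<Rightarrow> real vec set" where
  "feasible_set N A B Hx hx Hu hu \<epsilon> M p \<eta> x =
     {u \<in> carrier_vec (N * dim_col B).
        (\<Sum>j\<in>{1..M}. p j *
           of_bool (stacked_state N A B x u (\<eta> j) \<in> stacked_polytopic_set N Hx hx)) \<ge> 1 - \<epsilon> \<and>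
        u \<in> stacked_polytopic_set N Hu hu}"

definition tightened_set ::
  "nat \<Rightarrow> real mat \<Rightarrow> real mat \<Rightarrow> real mat \<Rightarrow> real vec \<Rightarrow> real mat \<Rightarrow> real vec \<Rightarrow> real \<Rightarrow>
   nat \<Rightarrow> (nat \<Rightarrow> real) \<Rightarrow> (nat \<Rightarrow> real vec) \<Rightarrow> (nat \<Rightarrow> real vec set) \<Rightarrow> real vec \<Rightarrow> real vec set" where
  "tightened_set N A B Hx hx Hu hu \<epsilon> M p \<eta> E x =
     {u \<in> carrier_vec (N * dim_col B).
        (\<Sum>j\<in>{1..M}. p j *
           of_bool (stacked_state N A B x u (\<eta> j)
             \<in> minkowski_diff (N * dim_row A) (stacked_polytopic_set N Hx hx) (E j))) \<ge> 1 - \<epsilon> \<and>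
        u \<in> stacked_polytopic_set N Hu hu}"

lemma stack_carrier: "stack d N v \<in> carrier_vec (N * d)"
  by (simp add: stack_def)

lemma sum_blocks:
  fixes f :: "nat \<Rightarrow> nat \<Rightarrow> real"
  shows "(\<Sum>c<N * d. f (c div d) (c mod d)) = (\<Sum>i<N. \<Sum>b<d. f i b)"
proof -
  have "(\<Sum>c<N * d. f (c div d) (c mod d)) =
        (\<Sum>i<N. \<Sum>c = i * d..<i * d + d. f (c div d) (c mod d))"
    by (rule sum.nat_group[symmetric])
  also have "\<dots> = (\<Sum>i<N. \<Sum>b<d. f i b)"
  proof (rule sum.cong[OF refl])
    fix i
    have "(\<Sum>c = i * d..<i * d + d. f (c div d) (c mod d)) =
          (\<Sum>b = 0..<d. f ((b + i * d) div d) ((b + i * d) mod d))"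
      using sum.shift_bounds_nat_ivl[of "\<lambda>c. f (c div d) (c mod d)" 0 "i * d" d]
      by (simp add: add.commute)
    also have "\<dots> = (\<Sum>b<d. f i b)"
      by (rule sum.cong) auto
    finally show "(\<Sum>c = i * d..<i * d + d. f (c div d) (c mod d)) = (\<Sum>b<d. f i b)" .
  qed
  finally show ?thesis .
qed

lemma mult_mat_vec_index_sum:
  assumes "P \<in> carrier_mat q d" "v \<in> carrier_vec d" "a < q"
  shows "(P *\<^sub>v v) $ a = (\<Sum>b<d. P $$ (a, b) * v $ b)"
  using assms by (auto simp: scalar_prod_def lessThan_atLeast0)

lemma G_mat_mult_stack:
  fixes A B :: "real mat"
  assumes A: "A \<in> carrier_mat n n" and B: "B \<in> carrier_mat n m"
    and w: "\<And>i. i < N \<Longrightarrow> w i \<in> carrier_vec m" and r: "r < N * n"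
  shows "(G_mat N A B *\<^sub>v stack m N w) $ r =
         (\<Sum>i\<le>r div n. ((A ^\<^sub>m (r div n - i) * B) *\<^sub>v w i) $ (r mod n))"
proof -
  have rn: "r div n < N"
    using r by (simp add: less_mult_imp_div_less)
  have rm: "r mod n < n"
    using r by (cases "n = 0") auto
  have P: "A ^\<^sub>m k * B \<in> carrier_mat n m" for k
    using A B by (auto intro: pow_carrier_mat)
  let ?f = "\<lambda>i b. if i \<le> r div n
    then (A ^\<^sub>m (r div n - i) * B) $$ (r mod n, b) * w i $ b else 0"
  have "(G_mat N A B *\<^sub>v stack m N w) $ r =
        (\<Sum>c<N * m. G_mat N A B $$ (r, c) * stack m N w $ c)"
    using A B r by (intro mult_mat_vec_index_sum[of _ "N * n"]) (auto simp: G_mat_def stack_def)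
  also have "\<dots> = (\<Sum>c<N * m. ?f (c div m) (c mod m))"
    using A B r by (intro sum.cong) (auto simp: G_mat_def stack_def)
  also have "\<dots> = (\<Sum>i<N. \<Sum>b<m. ?f i b)"
    by (rule sum_blocks)
  also have "\<dots> = (\<Sum>i<N. if i \<le> r div n
      then ((A ^\<^sub>m (r div n - i) * B) *\<^sub>v w i) $ (r mod n) else 0)"
    by (intro sum.cong refl)
      (auto simp del: index_mult_mat_vec simp: mult_mat_vec_index_sum[OF P w rm])
  also have "\<dots> = (\<Sum>i\<in>{..<N} \<inter> {i. i \<le> r div n}.
      ((A ^\<^sub>m (r div n - i) * B) *\<^sub>v w i) $ (r mod n))"
    by (simp add: sum.inter_restrict)
  also have "{..<N} \<inter> {i. i \<le> r div n} = {..r div n}"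
    using rn by auto
  finally show ?thesis .
qed

lemma dynamics_closed_form:
  fixes A B P :: "real mat"
  assumes A: "A \<in> carrier_mat n n" and B: "B \<in> carrier_mat n m"
    and x: "\<And>s. x s \<in> carrier_vec n" and u: "\<And>s. u s \<in> carrier_vec m"
    and w: "\<And>s. w s \<in> carrier_vec n"
    and dyn: "\<And>s. x (Suc s) = A *\<^sub>v x s + B *\<^sub>v u s + w s"
    and P: "P \<in> carrier_mat n n" and a: "a < n"
  shows "(P *\<^sub>v x k) $ a = ((P * A ^\<^sub>m k) *\<^sub>v x 0) $ a +
    (\<Sum>i<k. ((P * (A ^\<^sub>m (k - Suc i) * B)) *\<^sub>v u i) $ a) +
    (\<Sum>i<k. ((P * A ^\<^sub>m (k - Suc i)) *\<^sub>v w i) $ a)"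
  using P
proof (induction k arbitrary: P)
  case 0
  then show ?case using A by simp
next
  case (Suc k)
  note P = Suc.prems
  have Ak: "A ^\<^sub>m j \<in> carrier_mat n n" for j
    using A by (rule pow_carrier_mat)
  have Acomm: "A * A ^\<^sub>m j = A ^\<^sub>m Suc j" for j
  proof (induction j)
    case 0
    then show ?case using A by simp
  next
    case (Suc j)
    have "A * A ^\<^sub>m Suc j = (A * A ^\<^sub>m j) * A"
      using A Ak[of j] by (simp add: assoc_mult_mat[of A n n _ n A n])
    then show ?case using Suc by simp
  qed
  have comm: "P * A * A ^\<^sub>m j = P * A ^\<^sub>m Suc j" for j
    using assoc_mult_mat[OF P A Ak[of j]] Acomm[of j] by simp
  have commB: "P * A * (A ^\<^sub>m j * B) = P * (A ^\<^sub>m Suc j * B)" for j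
    using assoc_mult_mat[OF P A mult_carrier_mat[OF Ak[of j] B]]
      assoc_mult_mat[OF A Ak[of j] B] Acomm[of j] by simp
  have "P *\<^sub>v x (Suc k) = (P * A) *\<^sub>v x k + (P * B) *\<^sub>v u k + P *\<^sub>v w k"
  proof -
    have "P *\<^sub>v x (Suc k) = P *\<^sub>v (A *\<^sub>v x k + B *\<^sub>v u k) + P *\<^sub>v w k"
      unfolding dyn using A B x[of k] u[of k] w[of k] P
      by (intro mult_add_distrib_mat_vec) auto
    also have "P *\<^sub>v (A *\<^sub>v x k + B *\<^sub>v u k) = P *\<^sub>v (A *\<^sub>v x k) + P *\<^sub>v (B *\<^sub>v u k)"
      using A B x[of k] u[of k] P by (intro mult_add_distrib_mat_vec) auto
    finally show ?thesis
      using assoc_mult_mat_vec[OF P A x[of k]] assoc_mult_mat_vec[OF P B u[of k]] by simp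
  qed
  then have "(P *\<^sub>v x (Suc k)) $ a =
      ((P * A) *\<^sub>v x k) $ a + ((P * B) *\<^sub>v u k) $ a + (P *\<^sub>v w k) $ a"
    using a P by (simp del: index_mult_mat_vec)
  also have "((P * A) *\<^sub>v x k) $ a = ((P * A * A ^\<^sub>m k) *\<^sub>v x 0) $ a +
    (\<Sum>i<k. ((P * A * (A ^\<^sub>m (k - Suc i) * B)) *\<^sub>v u i) $ a) +
    (\<Sum>i<k. ((P * A * A ^\<^sub>m (k - Suc i)) *\<^sub>v w i) $ a)"
    by (rule Suc.IH) (use P A in auto)
  also have "(\<Sum>i<k. ((P * A * (A ^\<^sub>m (k - Suc i) * B)) *\<^sub>v u i) $ a) =
      (\<Sum>i<k. ((P * (A ^\<^sub>m (Suc k - Suc i) * B)) *\<^sub>v u i) $ a)"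
    by (intro sum.cong refl) (simp only: commB lessThan_iff diff_Suc_Suc Suc_diff_Suc)
  also have "(\<Sum>i<k. ((P * A * A ^\<^sub>m (k - Suc i)) *\<^sub>v w i) $ a) =
      (\<Sum>i<k. ((P * A ^\<^sub>m (Suc k - Suc i)) *\<^sub>v w i) $ a)"
    by (intro sum.cong refl) (simp only: comm lessThan_iff diff_Suc_Suc Suc_diff_Suc)
  finally show ?case
    using A B P comm[of k] by (simp del: index_mult_mat_vec pow_mat.simps(2))
qed

lemma stacked_dynamics:
  fixes A B :: "real mat"
  assumes A: "A \<in> carrier_mat n n" and B: "B \<in> carrier_mat n m"
    and x: "\<And>s. x s \<in> carrier_vec n" and u: "\<And>s. u s \<in> carrier_vec m"
    and w: "\<And>s. w s \<in> carrier_vec n"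
    and dyn: "\<And>s. x (Suc s) = A *\<^sub>v x s + B *\<^sub>v u s + w s"
  shows "stacked_state N A B (x t) (stack m N (\<lambda>i. u (t + i))) (stack n N (\<lambda>i. w (t + i))) =
         stack n N (\<lambda>k. x (t + k + 1))"
proof (rule eq_vecI)
  show "dim_vec (stacked_state N A B (x t) (stack m N (\<lambda>i. u (t + i))) (stack n N (\<lambda>i. w (t + i)))) =
      dim_vec (stack n N (\<lambda>k. x (t + k + 1)))"
    using A by (simp add: stacked_state_def Gamma_mat_def G_mat_def stack_def)
next
  fix r assume "r < dim_vec (stack n N (\<lambda>k. x (t + k + 1)))"
  then have r: "r < N * n" by (simp add: stack_def)
  define k a where "k = r div n" and "a = r mod n"
  have a: "a < n" using r by (cases "n = 0") (auto simp: a_def)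
  have Ak: "A ^\<^sub>m j \<in> carrier_mat n n" for j
    using A by (rule pow_carrier_mat)
  have F: "(F_mat N A *\<^sub>v x t) $ r = (A ^\<^sub>m Suc k *\<^sub>v x t) $ a"
  proof -
    have "(F_mat N A *\<^sub>v x t) $ r = (\<Sum>b<n. F_mat N A $$ (r, b) * x t $ b)"
      using A x r by (intro mult_mat_vec_index_sum[of _ "N * n"]) (auto simp: F_mat_def)
    also have "\<dots> = (\<Sum>b<n. (A ^\<^sub>m Suc k) $$ (a, b) * x t $ b)"
      using A r by (intro sum.cong) (auto simp: F_mat_def k_def a_def)
    also have "\<dots> = (A ^\<^sub>m Suc k *\<^sub>v x t) $ a"
      by (rule mult_mat_vec_index_sum[symmetric, OF Ak x a])
    finally show ?thesis .
  qed
  have "stacked_state N A B (x t) (stack m N (\<lambda>i. u (t + i))) (stack n N (\<lambda>i. w (t + i))) $ r =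
      (F_mat N A *\<^sub>v x t) $ r + (G_mat N A B *\<^sub>v stack m N (\<lambda>i. u (t + i))) $ r +
      (G_mat N A (1\<^sub>m n) *\<^sub>v stack n N (\<lambda>i. w (t + i))) $ r"
    using A r
    by (simp add: stacked_state_def Gamma_mat_def G_mat_def F_mat_def del: index_mult_mat_vec)
  also have "\<dots> = (A ^\<^sub>m Suc k *\<^sub>v x t) $ a +
      (\<Sum>i<Suc k. ((A ^\<^sub>m (k - i) * B) *\<^sub>v u (t + i)) $ a) +
      (\<Sum>i<Suc k. ((A ^\<^sub>m (k - i) * 1\<^sub>m n) *\<^sub>v w (t + i)) $ a)"
    using G_mat_mult_stack[OF A B u r] G_mat_mult_stack[OF A one_carrier_mat w r] F
    by (simp add: k_def a_def lessThan_Suc_atMost del: index_mult_mat_vec)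
  also have "\<dots> = (1\<^sub>m n *\<^sub>v x (t + Suc k)) $ a"
    using dynamics_closed_form[of A n B m "\<lambda>s. x (t + s)" "\<lambda>s. u (t + s)" "\<lambda>s. w (t + s)"
        "1\<^sub>m n" a "Suc k"] A B x u w dyn a Ak
      left_mult_one_mat[OF Ak] right_mult_one_mat[OF Ak]
      left_mult_one_mat[OF mult_carrier_mat[OF Ak B]]
    by (simp del: index_mult_mat_vec pow_mat.simps(2) sum.lessThan_Suc)
  also have "\<dots> = stack n N (\<lambda>k. x (t + k + 1)) $ r"
    using x r by (simp add: stack_def k_def a_def del: index_mult_mat_vec)
  finally show "stacked_state N A B (x t) (stack m N (\<lambda>i. u (t + i))) (stack n N (\<lambda>i. w (t + i))) $ r =
      stack n N (\<lambda>k. x (t + k + 1)) $ r" .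
qed

lemma stack_Suc:
  assumes "v 0 \<in> carrier_vec d"
  shows "stack d (Suc N) v = v 0 @\<^sub>v stack d N (\<lambda>k. v (Suc k))"
proof (rule eq_vecI)
  fix i assume i: "i < dim_vec (v 0 @\<^sub>v stack d N (\<lambda>k. v (Suc k)))"
  then have d: "0 < d" using assms by (cases d) (auto simp: stack_def)
  show "stack d (Suc N) v $ i = (v 0 @\<^sub>v stack d N (\<lambda>k. v (Suc k))) $ i"
  proof (cases "i < d")
    case True
    then show ?thesis using assms by (auto simp: stack_def)
  next
    case False
    then have "i div d = Suc ((i - d) div d)" "i mod d = (i - d) mod d"
      using d le_div_geq[of d i] le_mod_geq[of d i] by simp_all
    then show ?thesis using assms i False by (auto simp: stack_def)
  qed
qed (use assms in \<open>auto simp: stack_def\<close>)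

lemma stacked_polytopic_set_iff:
  assumes h: "dim_vec h = dim_row H" and v: "\<And>k. v k \<in> carrier_vec (dim_col H)"
  shows "stack (dim_col H) N v \<in> stacked_polytopic_set N H h \<longleftrightarrow>
         (\<forall>k<N. v k \<in> polytopic_set H h)"
  using v
proof (induction N arbitrary: v)
  case 0
  then show ?case
    by (auto simp: stacked_polytopic_set_def polytopic_set_def stack_def less_eq_vec_def)
next
  case (Suc N)
  let ?D = "diag_block_mat (replicate N H)"
  let ?w = "stack (dim_col H) N (\<lambda>k. v (Suc k))"
  have dims: "dim_row ?D = N * dim_row H" "dim_col ?D = N * dim_col H"
    by (simp_all add: dim_diag_block_mat sum_list_replicate)
  have H: "H \<in> carrier_mat (dim_row H) (dim_col H)" and D: "?D \<in> carrier_mat (N * dim_row H) (N * dim_col H)"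
    using dims by auto
  have w: "?w \<in> carrier_vec (N * dim_col H)" by (rule stack_carrier)
  have "diag_block_mat (replicate (Suc N) H) *\<^sub>v stack (dim_col H) (Suc N) v =
      (H *\<^sub>v v 0) @\<^sub>v (?D *\<^sub>v ?w)"
  proof -
    have "diag_block_mat (replicate (Suc N) H) *\<^sub>v stack (dim_col H) (Suc N) v =
      four_block_mat H (0\<^sub>m (dim_row H) (N * dim_col H)) (0\<^sub>m (N * dim_row H) (dim_col H)) ?D
        *\<^sub>v (v 0 @\<^sub>v ?w)"
      unfolding replicate_Suc diag_block_mat.simps Let_def dims stack_Suc[of v, OF Suc.prems] by (rule refl)
    also have "\<dots> = (H *\<^sub>v v 0 + 0\<^sub>m (dim_row H) (N * dim_col H) *\<^sub>v ?w) @\<^sub>v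
        (0\<^sub>m (N * dim_row H) (dim_col H) *\<^sub>v v 0 + ?D *\<^sub>v ?w)"
      by (rule four_block_mat_mult_vec[OF H _ _ D Suc.prems w]) auto
    also have "0\<^sub>m (dim_row H) (N * dim_col H) *\<^sub>v ?w = 0\<^sub>v (dim_row H)"
      using w by auto
    also have "0\<^sub>m (N * dim_row H) (dim_col H) *\<^sub>v v 0 = 0\<^sub>v (N * dim_row H)"
      using Suc.prems[of 0] by auto
    also have "H *\<^sub>v v 0 + 0\<^sub>v (dim_row H) = H *\<^sub>v v 0"
      by (rule right_zero_vec[OF mult_mat_vec_carrier[OF H Suc.prems]])
    also have "0\<^sub>v (N * dim_row H) + ?D *\<^sub>v ?w = ?D *\<^sub>v ?w"
      by (rule left_zero_vec[OF mult_mat_vec_carrier[OF D w]])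
    finally show ?thesis .
  qed
  note mult = this
  have hs: "stack (dim_vec h) (Suc N) (\<lambda>_. h) = h @\<^sub>v stack (dim_vec h) N (\<lambda>_. h)"
    by (rule stack_Suc[of "\<lambda>_. h", OF carrier_vec_dim_vec])
  have Hv: "H *\<^sub>v v 0 \<in> carrier_vec (dim_vec h)"
    using mult_mat_vec_carrier[OF H Suc.prems] unfolding h .
  have ineq: "diag_block_mat (replicate (Suc N) H) *\<^sub>v stack (dim_col H) (Suc N) v
      \<le> stack (dim_vec h) (Suc N) (\<lambda>_. h) \<longleftrightarrow>
      H *\<^sub>v v 0 \<le> h \<and> ?D *\<^sub>v ?w \<le> stack (dim_vec h) N (\<lambda>_. h)"
    unfolding mult hs by (rule append_vec_le[OF Hv carrier_vec_dim_vec])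
  have cols: "dim_col (diag_block_mat (replicate (Suc N) H)) = Suc N * dim_col H"
    by (simp add: Let_def dims)
  have "stack (dim_col H) (Suc N) v \<in> stacked_polytopic_set (Suc N) H h \<longleftrightarrow>
      v 0 \<in> polytopic_set H h \<and> ?w \<in> stacked_polytopic_set N H h"
    unfolding stacked_polytopic_set_def polytopic_set_def mem_Collect_eq ineq cols dims
    using Suc.prems[of 0] w stack_carrier[of "dim_col H" "Suc N" v] by simp
  also have "?w \<in> stacked_polytopic_set N H h \<longleftrightarrow> (\<forall>k<N. v (Suc k) \<in> polytopic_set H h)"
    by (rule Suc.IH) (rule Suc.prems)
  finally show ?case
    unfolding All_less_Suc2 .
qed

end

(* If the representative of a cluster satisfies the tightened state constraint, the error
   Gamma (eta_h - eta'_j), being covered by E_j, cannot push any scenario h of that cluster out of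
   the original constraint set. So each representative's weight p'_j, when it counts, is dominated
   by the weights p_h of its cluster, and the clusters partition the scenarios. *)
theory Submission
  imports Defs
begin

text \<open>The stacked state is affine in the disturbance with linear part
  \<open>Gamma_mat N A\<close>, so for fixed \<open>x\<close> and \<open>u\<close> replacing a
  scenario by its representative costs exactly the error vector that \<open>E j\<close> has to
  cover.\<close>

lemma stacked_state_eq_add_Gamma_diff:
  fixes A B :: "real mat"
  assumes "\<eta> \<in> carrier_vec (N * dim_row A)" and "\<eta>' \<in> carrier_vec (N * dim_row A)"
  shows "stacked_state N A B x u \<eta> =
         stacked_state N A B x u \<eta>' + Gamma_mat N A *\<^sub>v (\<eta> - \<eta>')"
proof -
  let ?d = "N * dim_row A"
  \<comment> \<open>The dimension of a matrix-vector product is the row count of the matrix, so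
    \<open>FG\<close> holds for every \<open>x\<close> and \<open>u\<close>.\<close>
  have Gamma: "Gamma_mat N A \<in> carrier_mat ?d ?d"
    and FG: "F_mat N A *\<^sub>v x + G_mat N A B *\<^sub>v u \<in> carrier_vec ?d"
    by (auto simp: Gamma_mat_def F_mat_def G_mat_def intro!: carrier_vecI)
  have "\<eta> = \<eta>' + (\<eta> - \<eta>')"
    using assms by auto
  then have "Gamma_mat N A *\<^sub>v \<eta> = Gamma_mat N A *\<^sub>v \<eta>' + Gamma_mat N A *\<^sub>v (\<eta> - \<eta>')"
    using mult_add_distrib_mat_vec[OF Gamma, of \<eta>' "\<eta> - \<eta>'"] assms by simp
  then show ?thesis
    unfolding stacked_state_def
    using assoc_add_vec[OF FG, of "Gamma_mat N A *\<^sub>v \<eta>'" "Gamma_mat N A *\<^sub>v (\<eta> - \<eta>')"]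
      mult_mat_vec_carrier[OF Gamma] assms by simp
qed

lemma cluster_subset:
  assumes "is_clustering l M \<eta> M' \<eta>' C" and "j \<in> {1..M'}"
  shows "C j \<subseteq> {1..M}"
  using assms unfolding is_clustering_def by blast

text \<open>In the \<open>\<exists>!\<close> clause of \<open>is_clustering\<close>, existence makes
  the clusters cover \<open>{1..M}\<close> and uniqueness makes them disjoint. This turns the
  cluster-wise bound into a bound on the probability over the original scenarios.\<close>

lemma sum_clusters:
  fixes f :: "nat \<Rightarrow> 'a::comm_monoid_add"
  assumes "is_clustering l M \<eta> M' \<eta>' C"
  shows "(\<Sum>j\<in>{1..M'}. \<Sum>h\<in>C j. f h) = (\<Sum>h\<in>{1..M}. f h)"
proof -
  note sub = cluster_subset[OF assms]
  have ex1: "\<forall>h\<in>{1..M}. \<exists>!j. j \<in> {1..M'} \<and> h \<in> C j"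
    using assms by (simp add: is_clustering_def)
  have "(\<Union>j\<in>{1..M'}. C j) = {1..M}"
  \<comment> \<open>One inclusion is already \<open>sub\<close>; what remains is that every scenario
    is covered.\<close>
  proof (rule antisym[OF UN_least[OF sub] subsetI])
    fix h assume "h \<in> {1..M}"
    then obtain j where "j \<in> {1..M'}" "h \<in> C j"
      using ex1_implies_ex[OF bspec[OF ex1]] by metis
    then show "h \<in> (\<Union>j\<in>{1..M'}. C j)"
      by (rule UN_I)
  qed
  moreover have "finite (C j)" if "j \<in> {1..M'}" for j
    using sub[OF that] by (rule finite_subset) simp
  moreover have "C i \<inter> C j = {}" if "i \<in> {1..M'}" "j \<in> {1..M'}" "i \<noteq> j" for i j
  proof (rule equals0I)
    fix h assume "h \<in> C i \<inter> C j"
    then have h: "h \<in> {1..M}" "h \<in> C i" "h \<in> C j"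
      using sub[OF that(1)] by auto
    have "i = j"
      using bspec[OF ex1 h(1)] h(2,3) that(1,2) by metis
    then show False
      using that by simp
  qed
  ultimately show ?thesis
    using sum.UNION_disjoint[of "{1..M'}" C f] by simp
qed

theorem theorem1:
  fixes n m N l M M' t :: nat
    and A B Hx Hu :: "real mat" and hx hu :: "real vec" and \<epsilon> :: real
    and p :: "nat \<Rightarrow> real" and \<eta> :: "nat \<Rightarrow> nat \<Rightarrow> real vec"
    and \<eta>' :: "nat \<Rightarrow> real vec" and p' :: "nat \<Rightarrow> real"
    and C :: "nat \<Rightarrow> nat set" and E :: "nat \<Rightarrow> real vec set"
  assumes "N \<ge> 1"
    and "A \<in> carrier_mat n n" and "B \<in> carrier_mat n m"
    and "dim_col Hx = n" and "dim_vec hx = dim_row Hx"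
    and "dim_col Hu = m" and "dim_vec hu = dim_row Hu"
    and "0 \<le> \<epsilon>" and "\<epsilon> < 1"
    and "\<forall>j\<in>{1..M}. \<forall>s. \<eta> j s \<in> carrier_vec n"
    and "\<forall>j\<in>{1..M}. 0 < p j \<and> p j \<le> 1" and "(\<Sum>j\<in>{1..M}. p j) = 1"
    and "M' < M" and "\<forall>j\<in>{1..M'}. \<eta>' j \<in> carrier_vec (N * n)"
    and "l \<in> {1, 2}"
    and "is_clustering l M (\<lambda>j. stack n N (\<lambda>k. \<eta> j (t + k))) M' \<eta>' C"
    and "\<forall>j\<in>{1..M'}. p' j = (\<Sum>h\<in>C j. p h)"
    and "\<forall>j\<in>{1..M'}. 0 < p' j \<and> p' j \<le> 1"
    and "\<forall>j\<in>{1..M'}. E j \<subseteq> carrier_vec (N * n)"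
    and "\<forall>j\<in>{1..M'}. \<forall>h\<in>C j.
           Gamma_mat N A *\<^sub>v (stack n N (\<lambda>k. \<eta> h (t + k)) - \<eta>' j) \<in> E j"
  shows "\<forall>x \<in> polytopic_set Hx hx.
           tightened_set N A B Hx hx Hu hu \<epsilon> M' p' \<eta>' E x
             \<subseteq> feasible_set N A B Hx hx Hu hu \<epsilon> M p
                 (\<lambda>j. stack n N (\<lambda>k. \<eta> j (t + k))) x"
proof (intro ballI subsetI)
  fix x u
  assume u: "u \<in> tightened_set N A B Hx hx Hu hu \<epsilon> M' p' \<eta>' E x"
  let ?\<eta> = "\<lambda>j. stack n N (\<lambda>k. \<eta> j (t + k))"
  let ?X = "stacked_polytopic_set N Hx hx"
  let ?T = "\<lambda>j. stacked_state N A B x u (\<eta>' j) \<in> minkowski_diff (N * dim_row A) ?X (E j)"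
  let ?S = "\<lambda>h. stacked_state N A B x u (?\<eta> h) \<in> ?X"
  have n: "dim_row A = n"
    using \<open>A \<in> carrier_mat n n\<close> by simp
  have p_nonneg: "0 \<le> p h" if "j \<in> {1..M'}" "h \<in> C j" for j h
  proof -
    have "h \<in> {1..M}"
      using cluster_subset[OF assms(16)] that by blast
    then show ?thesis
      using assms(11) by (simp add: less_imp_le)
  qed
  \<comment> \<open>The Minkowski difference quantifies over all of \<open>E j\<close>; it is
    instantiated at the error vector of scenario \<open>h\<close>.\<close>
  have imp: "?S h" if j: "j \<in> {1..M'}" and h: "h \<in> C j" and T: "?T j" for j h
  proof -
    have "stacked_state N A B x u (?\<eta> h) =
        stacked_state N A B x u (\<eta>' j) + Gamma_mat N A *\<^sub>v (?\<eta> h - \<eta>' j)"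
      using assms(14) j by (intro stacked_state_eq_add_Gamma_diff) (simp_all add: n stack_carrier)
    moreover have "Gamma_mat N A *\<^sub>v (?\<eta> h - \<eta>' j) \<in> E j"
      using assms(20) j h by blast
    ultimately show ?thesis
      using T by (simp add: minkowski_diff_def)
  qed
  have "1 - \<epsilon> \<le> (\<Sum>j\<in>{1..M'}. p' j * of_bool (?T j))"
    using u by (simp add: tightened_set_def)
  \<comment> \<open>The indicator depends on \<open>j\<close> alone, so it moves inside the sum that
    defines \<open>p' j\<close>.\<close>
  also have "\<dots> = (\<Sum>j\<in>{1..M'}. \<Sum>h\<in>C j. p h * of_bool (?T j))"
    using assms(17) by (intro sum.cong) (auto simp: sum_distrib_right)
  \<comment> \<open>Termwise comparison: \<open>imp\<close> orders the indicators, and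
    \<open>p_nonneg\<close> lets the weights preserve that order.\<close>
  also have "\<dots> \<le> (\<Sum>j\<in>{1..M'}. \<Sum>h\<in>C j. p h * of_bool (?S h))"
    by (intro sum_mono mult_left_mono p_nonneg) (use imp in \<open>auto simp: of_bool_def\<close>)
  also have "\<dots> = (\<Sum>h\<in>{1..M}. p h * of_bool (?S h))"
    by (rule sum_clusters) (rule assms(16))
  \<comment> \<open>The input constraint is the same in both sets and carries over.\<close>
  finally show "u \<in> feasible_set N A B Hx hx Hu hu \<epsilon> M p ?\<eta> x"
    using u by (simp add: tightened_set_def feasible_set_def)
qed

end
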